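(* Consider the optimal control problem $$(OC)\qquad\text{minimize } E\Big[\sum_{t=0}^TL_t(X_t,U_t)\Big]\ \text{ over }(X,U)\in\mathcal N\ \text{ subject to } \Delta X_t=A_tX_{t-1}+B_tU_{t-1}+W_t,\ t=1,\dots,T\ \text{a.s.}$$ and the dual problem $$(D_{OC})\qquad\text{maximize } E\Big[\sum_{t=1}^TW_t\cdot y_t-\sum_{t=0}^TL_t^*\big(p_t-(\Delta y_{t+1}+A_{t+1}^*y_{t+1},\,B_{t+1}^*y_{t+1})\big)\Big]\ \text{ over }(p,y)\in\mathcal X_a^\perp\times\mathcal Y.$$ If $\operatorname{dom}Ef\cap(\mathcal X\times\mathcal U)\neq\emptyset$ (i.e. $Ef(x,u)<\infty$ for some $(x,u)\in\mathcal X\times\mathcal U$) and $(OC)$ and $(D_{OC})$ are feasible, then the following are equivalent: 1. $(X,U)$ solves $(OC)$, $(p,y)$ solves $(D_{OC})$ and there is no duality gap (i.e. $\inf(OC)=\sup(D_{OC})$); 2. $(X,U)$ is feasible in $(OC)$, $(p,y)$ is feasible in $(D_{OC})$ and, almost surely, $$p_t-(\Delta y_{t+1}+A_{t+1}^*y_{t+1},\,B_{t+1}^*y_{t+1})\in\partial L_t(X_t,U_t),\qquad t=0,\dots,T,$$ $$\Delta X_t=A_tX_{t-1}+B_tU_{t-1}+W_t,\qquad t=1,\dots,T.$$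
   Context: $(\Omega,\mathcal F,P)$ is a probability space with a filtration $(\mathcal F_t)_{t=0}^T$ (an increasing sequence of sub-$\sigma$-algebras of $\mathcal F$). Random variables equal a.s. are identified. The expectation of an extended real-valued random variable is $+\infty$ unless its positive part is integrable; the dual objective is read as $E[\sum_{t=1}^TW_t\cdot y_t]-E[\sum_{t=0}^TL_t^*(\cdot)]$. $x=(X,U)$ with $x_t=(X_t,U_t)$ taking values in $\mathbb R^N\times\mathbb R^M$, $t=0,\dots,T$; $\mathcal N$ is the space of all such processes in $L^0$ with $x_t$ $\mathcal F_t$-measurable for all $t$. $\Delta X_t:=X_t-X_{t-1}$. $A_t\in L^0(\mathbb R^{N\times N})$, $B_t\in L^0(\mathbb R^{N\times M})$ and $W_t\in L^0(\mathbb R^N)$ are $\mathcal F_t$-measurable; $A_t^*,B_t^*$ are scenariowise transposes. $L_t$ are convex normal integrands on $\mathbb R^N\times\mathbb R^M\times\Omega$ ($L_t(\cdot,\omega)$ closed convex for every $\omega$ and $\omega\mapsto\operatorname{epi}L_t(\cdot,\omega)$ measurable), $L_t^*$ is the $\omega$-wise conjugate and $\partial L_t$ the $\omega$-wise subdifferential. For $y=(y_t)_{t=1}^T$ set $y_0:=0$, $y_{T+1}:=0$, $A_{T+1}:=0$, $B_{T+1}:=0$, $\Delta y_{t+1}:=y_{t+1}-y_t$. $f(x,u,\omega):=\sum_{t=0}^TL_t(X_t,U_t,\omega)+\sum_{t=1}^T\delta_{\{0\}}(\Delta X_t-A_t(\omega)X_{t-1}-B_t(\omega)U_{t-1}-u_t)$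 for $u=(u_t)_{t=1}^T$, $u_t\in\mathbb R^N$, where $\delta_{\{0\}}(0)=0$ and $\delta_{\{0\}}=+\infty$ elsewhere; $Ef(x,u):=\int f(x(\omega),u(\omega),\omega)dP(\omega)$. A linear space of $\mathbb R^k$-valued random variables is decomposable if it contains $1_Au+1_{\Omega\setminus A}u'$ for all its elements $u$, all $u'\in L^\infty$, $A\in\mathcal F$; it is solid if it contains every $u\in L^0$ with $|u^i|\le|\bar u^i|$ a.s. for all $i$ for some element $\bar u$. $\mathcal S,\mathcal S'$ are solid decomposable spaces of $\mathbb R^N$-valued random variables in separating duality under $E[\,\cdot\,]$ of the inner product; likewise $\mathcal C,\mathcal C'$ for $\mathbb R^M$-valued ones. $\mathcal X=(\mathcal S\times\mathcal C)^{T+1}$, $\mathcal V=(\mathcal S'\times\mathcal C')^{T+1}$, $\mathcal U=\mathcal S^T$, $\mathcal Y=(\mathcal S')^T$, and $(W_1,\dots,W_T)\in\mathcal U$. $\mathcal X_a:=\mathcal X\cap\mathcal N$, $\mathcal X_a^\perp:=\{v\in\mathcal V: E[x\cdot v]=0\ \forall x\in\mathcal X_a\}$. Feasible in $(OC)$: $(X,U)\in\mathcal N$, system equations hold and $E[\sum_tL_t(X_t,U_t)]<\infty$. Feasible in $(D_{OC})$: $(p,y)\in\mathcal X_a^\perp\times\mathcal Y$ with $E[\sum_tL_t^*(\cdot)]<\infty$ at the arguments above. A problem is feasible if it has a feasible point; "solves" means feasible and attaining the optimum value. *)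

theory Defs
  imports "HOL-Probability.Probability"
begin

section \<open>Expectation of extended real-valued random variables\<close>

text \<open>The value is \<open>\<infinity>\<close> unless the positive part is integrable. Since \<open>e2ennreal\<close> maps negative
  numbers to 0, the two integrals are those of the positive and of the negative part. In sums of
  extended reals, \<open>\<infinity> + (-\<infinity>) = \<infinity>\<close> as in the library.\<close>

definition ext_expectation :: "'w measure \<Rightarrow> ('w \<Rightarrow> ereal) \<Rightarrow> ereal" where
  "ext_expectation M g =
     (if (\<integral>\<^sup>+ w. e2ennreal (g w) \<partial>M) = \<infinity> then \<infinity>
      else enn2ereal (\<integral>\<^sup>+ w. e2ennreal (g w) \<partial>M) - enn2ereal (\<integral>\<^sup>+ w. e2ennreal (- g w) \<partial>M))"


section \<open>Convex analysis\<close>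

definition epi :: "('a \<Rightarrow> ereal) \<Rightarrow> ('a \<times> real) set" where
  "epi g = {(x, r). g x \<le> ereal r}"

definition fenchel_conjugate :: "('a::real_inner \<Rightarrow> ereal) \<Rightarrow> 'a \<Rightarrow> ereal" where
  "fenchel_conjugate g v = (SUP x. ereal (x \<bullet> v) - g x)"

definition subdifferential :: "('a::real_inner \<Rightarrow> ereal) \<Rightarrow> 'a \<Rightarrow> 'a set" where
  "subdifferential g x = {v. \<forall>z. g x + ereal (v \<bullet> (z - x)) \<le> g z}"

definition indicator_zero :: "'a::zero \<Rightarrow> ereal" where
  "indicator_zero z = (if z = 0 then 0 else \<infinity>)"

text \<open>Closedness and convexity of a function are closedness and convexity of its epigraph, and a
  set-valued mapping is measurable if the preimages of open sets are measurable.\<close>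

definition convex_normal_integrand ::
    "'w measure \<Rightarrow> ('a::euclidean_space \<Rightarrow> 'w \<Rightarrow> ereal) \<Rightarrow> bool" where
  "convex_normal_integrand M h \<longleftrightarrow>
     (\<forall>w\<in>space M. closed (epi (\<lambda>x. h x w)) \<and> convex (epi (\<lambda>x. h x w))) \<and>
     (\<forall>G. open G \<longrightarrow> {w \<in> space M. epi (\<lambda>x. h x w) \<inter> G \<noteq> {}} \<in> sets M)"


section \<open>Spaces of random variables\<close>

text \<open>Random variables are represented by measurable functions. A solid space is closed under
  almost sure equality, so it is a space of equivalence classes.\<close>

definition random_linear_space :: "'w measure \<Rightarrow> ('w \<Rightarrow> real^'k) set \<Rightarrow> bool" where
  "random_linear_space M S \<longleftrightarrow>
     S \<subseteq> borel_measurable M \<and> (\<lambda>_. 0) \<in> S \<and>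
     (\<forall>u\<in>S. \<forall>v\<in>S. (\<lambda>w. u w + v w) \<in> S) \<and>
     (\<forall>c. \<forall>u\<in>S. (\<lambda>w. c *\<^sub>R u w) \<in> S)"

definition ess_bounded :: "'w measure \<Rightarrow> ('w \<Rightarrow> real^'k) set" where
  "ess_bounded M = {u \<in> borel_measurable M. \<exists>c. AE w in M. norm (u w) \<le> c}"

definition decomposable :: "'w measure \<Rightarrow> ('w \<Rightarrow> real^'k) set \<Rightarrow> bool" where
  "decomposable M S \<longleftrightarrow>
     (\<forall>u\<in>S. \<forall>u'\<in>ess_bounded M. \<forall>A\<in>sets M. (\<lambda>w. if w \<in> A then u w else u' w) \<in> S)"

definition solid :: "'w measure \<Rightarrow> ('w \<Rightarrow> real^'k) set \<Rightarrow> bool" where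
  "solid M S \<longleftrightarrow>
     (\<forall>u\<in>borel_measurable M. \<forall>v\<in>S. (\<forall>i. AE w in M. \<bar>u w $ i\<bar> \<le> \<bar>v w $ i\<bar>) \<longrightarrow> u \<in> S)"

definition solid_decomposable_space :: "'w measure \<Rightarrow> ('w \<Rightarrow> real^'k) set \<Rightarrow> bool" where
  "solid_decomposable_space M S \<longleftrightarrow> random_linear_space M S \<and> decomposable M S \<and> solid M S"

definition separating_duality ::
    "'w measure \<Rightarrow> ('w \<Rightarrow> real^'k) set \<Rightarrow> ('w \<Rightarrow> real^'k) set \<Rightarrow> bool" where
  "separating_duality M S S' \<longleftrightarrow>
     (\<forall>u\<in>S. \<forall>v\<in>S'. integrable M (\<lambda>w. u w \<bullet> v w)) \<and>
     (\<forall>u\<in>S. (\<forall>v\<in>S'. (\<integral>w. u w \<bullet> v w \<partial>M) = 0) \<longrightarrow> (AE w in M. u w = 0)) \<and>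
     (\<forall>v\<in>S'. (\<forall>u\<in>S. (\<integral>w. u w \<bullet> v w \<partial>M) = 0) \<longrightarrow> (AE w in M. v w = 0))"


section \<open>Processes\<close>

text \<open>A process with values in \<open>\<real>\<^sup>N \<times> \<real>\<^sup>M\<close> is a function \<open>x :: nat \<Rightarrow> 'w \<Rightarrow> (real^'n) \<times> (real^'m)\<close>
  whose components are the state \<open>fst (x t w)\<close> and the control \<open>snd (x t w)\<close>. Only the times
  \<open>0, \<dots>, T\<close> (or \<open>1, \<dots>, T\<close>, for \<open>u\<close>, \<open>y\<close>, \<open>A\<close>, \<open>B\<close> and \<open>W\<close>) matter; values at other times are
  unconstrained and never used.\<close>

definition finite_filtration :: "'w measure \<Rightarrow> nat \<Rightarrow> (nat \<Rightarrow> 'w measure) \<Rightarrow> bool" where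
  "finite_filtration M T F \<longleftrightarrow>
     (\<forall>t\<le>T. subalgebra M (F t)) \<and> (\<forall>s t. s \<le> t \<and> t \<le> T \<longrightarrow> sets (F s) \<subseteq> sets (F t))"

definition adapted_processes ::
    "nat \<Rightarrow> (nat \<Rightarrow> 'w measure) \<Rightarrow> (nat \<Rightarrow> 'w \<Rightarrow> (real^'n) \<times> (real^'m)) set" where
  "adapted_processes T F = {x. \<forall>t\<le>T. x t \<in> borel_measurable (F t)}"

definition pair_processes ::
    "nat \<Rightarrow> ('w \<Rightarrow> real^'n) set \<Rightarrow> ('w \<Rightarrow> real^'m) set \<Rightarrow> (nat \<Rightarrow> 'w \<Rightarrow> (real^'n) \<times> (real^'m)) set"
  where
  "pair_processes T S C = {x. \<forall>t\<le>T. (\<lambda>w. fst (x t w)) \<in> S \<and> (\<lambda>w. snd (x t w)) \<in> C}"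

definition state_processes :: "nat \<Rightarrow> ('w \<Rightarrow> real^'n) set \<Rightarrow> (nat \<Rightarrow> 'w \<Rightarrow> real^'n) set" where
  "state_processes T S = {u. \<forall>t\<in>{1..T}. u t \<in> S}"

definition adapted_perp ::
    "'w measure \<Rightarrow> nat \<Rightarrow> (nat \<Rightarrow> 'w measure) \<Rightarrow>
     ('w \<Rightarrow> real^'n) set \<Rightarrow> ('w \<Rightarrow> real^'n) set \<Rightarrow> ('w \<Rightarrow> real^'m) set \<Rightarrow> ('w \<Rightarrow> real^'m) set \<Rightarrow>
     (nat \<Rightarrow> 'w \<Rightarrow> (real^'n) \<times> (real^'m)) set" where
  "adapted_perp M T F S S' C C' =
     {v \<in> pair_processes T S' C'.
        \<forall>x \<in> pair_processes T S C \<inter> adapted_processes T F.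
          (\<integral>w. (\<Sum>t\<le>T. x t w \<bullet> v t w) \<partial>M) = 0}"


section \<open>The primal problem\<close>

text \<open>The \<open>\<omega>\<close>-wise system equation \<open>\<Delta>X\<^sub>t = A\<^sub>t X\<^sub>t\<^sub>-\<^sub>1 + B\<^sub>t U\<^sub>t\<^sub>-\<^sub>1 + W\<^sub>t\<close>.\<close>

definition system_equation ::
    "(nat \<Rightarrow> 'w \<Rightarrow> real^'n^'n) \<Rightarrow> (nat \<Rightarrow> 'w \<Rightarrow> real^'m^'n) \<Rightarrow> (nat \<Rightarrow> 'w \<Rightarrow> real^'n) \<Rightarrow>
     (nat \<Rightarrow> 'w \<Rightarrow> (real^'n) \<times> (real^'m)) \<Rightarrow> nat \<Rightarrow> 'w \<Rightarrow> bool" where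
  "system_equation A B W x t w \<longleftrightarrow>
     fst (x t w) - fst (x (t - 1) w) =
       A t w *v fst (x (t - 1) w) + B t w *v snd (x (t - 1) w) + W t w"

text \<open>The integrand \<open>f\<close>, whose arguments \<open>\<xi>\<close> and \<open>u\<close> are deterministic sequences.\<close>

definition oc_integrand ::
    "nat \<Rightarrow> (nat \<Rightarrow> 'w \<Rightarrow> real^'n^'n) \<Rightarrow> (nat \<Rightarrow> 'w \<Rightarrow> real^'m^'n) \<Rightarrow>
     (nat \<Rightarrow> (real^'n) \<times> (real^'m) \<Rightarrow> 'w \<Rightarrow> ereal) \<Rightarrow>
     (nat \<Rightarrow> (real^'n) \<times> (real^'m)) \<Rightarrow> (nat \<Rightarrow> real^'n) \<Rightarrow> 'w \<Rightarrow> ereal" where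
  "oc_integrand T A B L \<xi> u w =
     (\<Sum>t\<le>T. L t (\<xi> t) w) +
     (\<Sum>t=1..T. indicator_zero
        (fst (\<xi> t) - fst (\<xi> (t - 1)) - A t w *v fst (\<xi> (t - 1)) - B t w *v snd (\<xi> (t - 1)) - u t))"

definition dom_Ef ::
    "'w measure \<Rightarrow> nat \<Rightarrow> (nat \<Rightarrow> 'w \<Rightarrow> real^'n^'n) \<Rightarrow> (nat \<Rightarrow> 'w \<Rightarrow> real^'m^'n) \<Rightarrow>
     (nat \<Rightarrow> (real^'n) \<times> (real^'m) \<Rightarrow> 'w \<Rightarrow> ereal) \<Rightarrow>
     ((nat \<Rightarrow> 'w \<Rightarrow> (real^'n) \<times> (real^'m)) \<times> (nat \<Rightarrow> 'w \<Rightarrow> real^'n)) set" where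
  "dom_Ef M T A B L =
     {(x, u). ext_expectation M (\<lambda>w. oc_integrand T A B L (\<lambda>t. x t w) (\<lambda>t. u t w) w) < \<infinity>}"

definition oc_objective ::
    "'w measure \<Rightarrow> nat \<Rightarrow> (nat \<Rightarrow> (real^'n) \<times> (real^'m) \<Rightarrow> 'w \<Rightarrow> ereal) \<Rightarrow>
     (nat \<Rightarrow> 'w \<Rightarrow> (real^'n) \<times> (real^'m)) \<Rightarrow> ereal" where
  "oc_objective M T L x = ext_expectation M (\<lambda>w. \<Sum>t\<le>T. L t (x t w) w)"

definition oc_constraint_set ::
    "'w measure \<Rightarrow> nat \<Rightarrow> (nat \<Rightarrow> 'w measure) \<Rightarrow> (nat \<Rightarrow> 'w \<Rightarrow> real^'n^'n) \<Rightarrow>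
     (nat \<Rightarrow> 'w \<Rightarrow> real^'m^'n) \<Rightarrow> (nat \<Rightarrow> 'w \<Rightarrow> real^'n) \<Rightarrow>
     (nat \<Rightarrow> 'w \<Rightarrow> (real^'n) \<times> (real^'m)) set" where
  "oc_constraint_set M T F A B W =
     {x \<in> adapted_processes T F. AE w in M. \<forall>t\<in>{1..T}. system_equation A B W x t w}"

definition oc_value ::
    "'w measure \<Rightarrow> nat \<Rightarrow> (nat \<Rightarrow> 'w measure) \<Rightarrow> (nat \<Rightarrow> 'w \<Rightarrow> real^'n^'n) \<Rightarrow>
     (nat \<Rightarrow> 'w \<Rightarrow> real^'m^'n) \<Rightarrow> (nat \<Rightarrow> 'w \<Rightarrow> real^'n) \<Rightarrow>
     (nat \<Rightarrow> (real^'n) \<times> (real^'m) \<Rightarrow> 'w \<Rightarrow> ereal) \<Rightarrow> ereal" where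
  "oc_value M T F A B W L = (INF x \<in> oc_constraint_set M T F A B W. oc_objective M T L x)"

definition oc_feasible ::
    "'w measure \<Rightarrow> nat \<Rightarrow> (nat \<Rightarrow> 'w measure) \<Rightarrow> (nat \<Rightarrow> 'w \<Rightarrow> real^'n^'n) \<Rightarrow>
     (nat \<Rightarrow> 'w \<Rightarrow> real^'m^'n) \<Rightarrow> (nat \<Rightarrow> 'w \<Rightarrow> real^'n) \<Rightarrow>
     (nat \<Rightarrow> (real^'n) \<times> (real^'m) \<Rightarrow> 'w \<Rightarrow> ereal) \<Rightarrow>
     (nat \<Rightarrow> 'w \<Rightarrow> (real^'n) \<times> (real^'m)) \<Rightarrow> bool" where
  "oc_feasible M T F A B W L x \<longleftrightarrow>
     x \<in> oc_constraint_set M T F A B W \<and> oc_objective M T L x < \<infinity>"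

definition oc_solves ::
    "'w measure \<Rightarrow> nat \<Rightarrow> (nat \<Rightarrow> 'w measure) \<Rightarrow> (nat \<Rightarrow> 'w \<Rightarrow> real^'n^'n) \<Rightarrow>
     (nat \<Rightarrow> 'w \<Rightarrow> real^'m^'n) \<Rightarrow> (nat \<Rightarrow> 'w \<Rightarrow> real^'n) \<Rightarrow>
     (nat \<Rightarrow> (real^'n) \<times> (real^'m) \<Rightarrow> 'w \<Rightarrow> ereal) \<Rightarrow>
     (nat \<Rightarrow> 'w \<Rightarrow> (real^'n) \<times> (real^'m)) \<Rightarrow> bool" where
  "oc_solves M T F A B W L x \<longleftrightarrow>
     oc_feasible M T F A B W L x \<and> oc_objective M T L x = oc_value M T F A B W L"


section \<open>The dual problem\<close>

text \<open>The conventions \<open>y\<^sub>0 = y\<^sub>T\<^sub>+\<^sub>1 = 0\<close>, \<open>A\<^sub>T\<^sub>+\<^sub>1 = 0\<close> and \<open>B\<^sub>T\<^sub>+\<^sub>1 = 0\<close>.\<close>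

definition zero_ext :: "nat \<Rightarrow> (nat \<Rightarrow> 'w \<Rightarrow> 'a::zero) \<Rightarrow> nat \<Rightarrow> 'w \<Rightarrow> 'a" where
  "zero_ext T z t w = (if t \<in> {1..T} then z t w else 0)"

text \<open>The argument \<open>p\<^sub>t - (\<Delta>y\<^sub>t\<^sub>+\<^sub>1 + A\<^sup>*\<^sub>t\<^sub>+\<^sub>1 y\<^sub>t\<^sub>+\<^sub>1, B\<^sup>*\<^sub>t\<^sub>+\<^sub>1 y\<^sub>t\<^sub>+\<^sub>1)\<close> of the conjugate of \<open>L\<^sub>t\<close>.\<close>

definition dual_arg ::
    "nat \<Rightarrow> (nat \<Rightarrow> 'w \<Rightarrow> real^'n^'n) \<Rightarrow> (nat \<Rightarrow> 'w \<Rightarrow> real^'m^'n) \<Rightarrow>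
     (nat \<Rightarrow> 'w \<Rightarrow> (real^'n) \<times> (real^'m)) \<Rightarrow> (nat \<Rightarrow> 'w \<Rightarrow> real^'n) \<Rightarrow>
     nat \<Rightarrow> 'w \<Rightarrow> (real^'n) \<times> (real^'m)" where
  "dual_arg T A B p y t w =
     p t w -
     (zero_ext T y (t + 1) w - zero_ext T y t w
        + transpose (zero_ext T A (t + 1) w) *v zero_ext T y (t + 1) w,
      transpose (zero_ext T B (t + 1) w) *v zero_ext T y (t + 1) w)"

definition conj_cost ::
    "'w measure \<Rightarrow> nat \<Rightarrow> (nat \<Rightarrow> 'w \<Rightarrow> real^'n^'n) \<Rightarrow> (nat \<Rightarrow> 'w \<Rightarrow> real^'m^'n) \<Rightarrow>
     (nat \<Rightarrow> (real^'n) \<times> (real^'m) \<Rightarrow> 'w \<Rightarrow> ereal) \<Rightarrow>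
     (nat \<Rightarrow> 'w \<Rightarrow> (real^'n) \<times> (real^'m)) \<Rightarrow> (nat \<Rightarrow> 'w \<Rightarrow> real^'n) \<Rightarrow> ereal" where
  "conj_cost M T A B L p y =
     ext_expectation M
       (\<lambda>w. \<Sum>t\<le>T. fenchel_conjugate (\<lambda>\<xi>. L t \<xi> w) (dual_arg T A B p y t w))"

definition dual_objective ::
    "'w measure \<Rightarrow> nat \<Rightarrow> (nat \<Rightarrow> 'w \<Rightarrow> real^'n^'n) \<Rightarrow> (nat \<Rightarrow> 'w \<Rightarrow> real^'m^'n) \<Rightarrow>
     (nat \<Rightarrow> 'w \<Rightarrow> real^'n) \<Rightarrow> (nat \<Rightarrow> (real^'n) \<times> (real^'m) \<Rightarrow> 'w \<Rightarrow> ereal) \<Rightarrow>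
     (nat \<Rightarrow> 'w \<Rightarrow> (real^'n) \<times> (real^'m)) \<Rightarrow> (nat \<Rightarrow> 'w \<Rightarrow> real^'n) \<Rightarrow> ereal" where
  "dual_objective M T A B W L p y =
     ereal (\<integral>w. (\<Sum>t=1..T. W t w \<bullet> y t w) \<partial>M) - conj_cost M T A B L p y"

definition dual_constraint_set ::
    "'w measure \<Rightarrow> nat \<Rightarrow> (nat \<Rightarrow> 'w measure) \<Rightarrow>
     ('w \<Rightarrow> real^'n) set \<Rightarrow> ('w \<Rightarrow> real^'n) set \<Rightarrow> ('w \<Rightarrow> real^'m) set \<Rightarrow> ('w \<Rightarrow> real^'m) set \<Rightarrow>
     ((nat \<Rightarrow> 'w \<Rightarrow> (real^'n) \<times> (real^'m)) \<times> (nat \<Rightarrow> 'w \<Rightarrow> real^'n)) set" where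
  "dual_constraint_set M T F S S' C C' = adapted_perp M T F S S' C C' \<times> state_processes T S'"

definition dual_value ::
    "'w measure \<Rightarrow> nat \<Rightarrow> (nat \<Rightarrow> 'w measure) \<Rightarrow>
     ('w \<Rightarrow> real^'n) set \<Rightarrow> ('w \<Rightarrow> real^'n) set \<Rightarrow> ('w \<Rightarrow> real^'m) set \<Rightarrow> ('w \<Rightarrow> real^'m) set \<Rightarrow>
     (nat \<Rightarrow> 'w \<Rightarrow> real^'n^'n) \<Rightarrow> (nat \<Rightarrow> 'w \<Rightarrow> real^'m^'n) \<Rightarrow> (nat \<Rightarrow> 'w \<Rightarrow> real^'n) \<Rightarrow>
     (nat \<Rightarrow> (real^'n) \<times> (real^'m) \<Rightarrow> 'w \<Rightarrow> ereal) \<Rightarrow> ereal" where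
  "dual_value M T F S S' C C' A B W L =
     (SUP (p, y) \<in> dual_constraint_set M T F S S' C C'. dual_objective M T A B W L p y)"

definition dual_feasible ::
    "'w measure \<Rightarrow> nat \<Rightarrow> (nat \<Rightarrow> 'w measure) \<Rightarrow>
     ('w \<Rightarrow> real^'n) set \<Rightarrow> ('w \<Rightarrow> real^'n) set \<Rightarrow> ('w \<Rightarrow> real^'m) set \<Rightarrow> ('w \<Rightarrow> real^'m) set \<Rightarrow>
     (nat \<Rightarrow> 'w \<Rightarrow> real^'n^'n) \<Rightarrow> (nat \<Rightarrow> 'w \<Rightarrow> real^'m^'n) \<Rightarrow>
     (nat \<Rightarrow> (real^'n) \<times> (real^'m) \<Rightarrow> 'w \<Rightarrow> ereal) \<Rightarrow>
     (nat \<Rightarrow> 'w \<Rightarrow> (real^'n) \<times> (real^'m)) \<Rightarrow> (nat \<Rightarrow> 'w \<Rightarrow> real^'n) \<Rightarrow> bool" where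
  "dual_feasible M T F S S' C C' A B L p y \<longleftrightarrow>
     (p, y) \<in> dual_constraint_set M T F S S' C C' \<and> conj_cost M T A B L p y < \<infinity>"

definition dual_solves ::
    "'w measure \<Rightarrow> nat \<Rightarrow> (nat \<Rightarrow> 'w measure) \<Rightarrow>
     ('w \<Rightarrow> real^'n) set \<Rightarrow> ('w \<Rightarrow> real^'n) set \<Rightarrow> ('w \<Rightarrow> real^'m) set \<Rightarrow> ('w \<Rightarrow> real^'m) set \<Rightarrow>
     (nat \<Rightarrow> 'w \<Rightarrow> real^'n^'n) \<Rightarrow> (nat \<Rightarrow> 'w \<Rightarrow> real^'m^'n) \<Rightarrow> (nat \<Rightarrow> 'w \<Rightarrow> real^'n) \<Rightarrow>
     (nat \<Rightarrow> (real^'n) \<times> (real^'m) \<Rightarrow> 'w \<Rightarrow> ereal) \<Rightarrow>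
     (nat \<Rightarrow> 'w \<Rightarrow> (real^'n) \<times> (real^'m)) \<Rightarrow> (nat \<Rightarrow> 'w \<Rightarrow> real^'n) \<Rightarrow> bool" where
  "dual_solves M T F S S' C C' A B W L p y \<longleftrightarrow>
     dual_feasible M T F S S' C C' A B L p y \<and>
     dual_objective M T A B W L p y = dual_value M T F S S' C C' A B W L"

end

theory Submission
  imports Defs
begin

text \<open>For feasible points, Fenchel's inequality and summation by parts along the system equations give,
  almost surely,
  \<open>\<Sum>\<^sub>t L\<^sub>t(x\<^sub>t) + \<Sum>\<^sub>t L\<^sub>t\<^sup>*(v\<^sub>t) \<ge> \<Sum>\<^sub>t x\<^sub>t \<cdot> p\<^sub>t + \<Sum>\<^sub>t W\<^sub>t \<cdot> y\<^sub>t\<close>, where \<open>v\<^sub>t\<close> is the argument of the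
  conjugate, with equality exactly when every \<open>v\<^sub>t\<close> is a subgradient at \<open>x\<^sub>t\<close>. Thus
  \<open>\<Sum>\<^sub>t x\<^sub>t \<cdot> p\<^sub>t\<close> is bounded above by an integrable function. Although \<open>x\<close> need not lie in \<open>\<X>\<close>, this forces
  the expectation of \<open>\<Sum>\<^sub>t x\<^sub>t \<cdot> p\<^sub>t\<close> to be 0: cut \<open>x\<close> off on the \<open>F\<^sub>t\<close>-measurable sets
  \<open>{\<bar>x\<^sub>t\<bar> \<le> k}\<close>, one time after the other. Taking expectations yields weak duality, with equality of
  the two objectives exactly when the subgradient inclusions hold almost surely.\<close>

section \<open>Measurability of normal integrands and their conjugates\<close>

text \<open>An open set in the product is a countable union of basic boxes. For one box the event
  splits into \<open>\<Gamma>\<close> hitting the first side and \<open>v\<close> lying in the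
  second, and both events are measurable.\<close>

lemma sets_hit_open_product:
  fixes \<Gamma> :: "'w \<Rightarrow> 'a::second_countable_topology set" and v :: "'w \<Rightarrow> 'b::second_countable_topology"
  assumes hit: "\<And>G. open G \<Longrightarrow> {w \<in> space M. \<Gamma> w \<inter> G \<noteq> {}} \<in> sets M"
    and v: "v \<in> borel_measurable M" and H: "open H"
  shows "{w \<in> space M. \<exists>z\<in>\<Gamma> w. (z, v w) \<in> H} \<in> sets M"
proof -
  obtain \<A> :: "'a set set" where \<A>: "countable \<A>" "topological_basis \<A>"
    using ex_countable_basis by blast
  obtain \<B> :: "'b set set" where \<B>: "countable \<B>" "topological_basis \<B>"
    using ex_countable_basis by blast
  define R where "R = {(a, b) \<in> \<A> \<times> \<B>. a \<times> b \<subseteq> H}"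
  have "countable R"
    unfolding R_def by (rule countable_subset[of _ "\<A> \<times> \<B>"]) (use \<A> \<B> in auto)
  have cover: "(z, u) \<in> H \<longleftrightarrow> (\<exists>(a, b)\<in>R. z \<in> a \<and> u \<in> b)" for z u
  proof
    assume "(z, u) \<in> H"
    then obtain c where "c \<in> (\<lambda>(a, b). a \<times> b) ` (\<A> \<times> \<B>)" "(z, u) \<in> c" "c \<subseteq> H"
      using topological_basisE[OF topological_basis_prod[OF \<A>(2) \<B>(2)] H] by blast
    then show "\<exists>(a, b)\<in>R. z \<in> a \<and> u \<in> b"
      unfolding R_def by fastforce
  qed (auto simp: R_def)
  have "{w \<in> space M. \<exists>z\<in>\<Gamma> w. (z, v w) \<in> H} =
      (\<Union>q\<in>R. {w \<in> space M. \<Gamma> w \<inter> fst q \<noteq> {}} \<inter> (v -` snd q \<inter> space M))"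
    unfolding cover by (simp add: case_prod_unfold) blast
  moreover have "{w \<in> space M. \<Gamma> w \<inter> fst q \<noteq> {}} \<inter> (v -` snd q \<inter> space M) \<in> sets M"
    if "q \<in> R" for q
  proof -
    have "open (fst q)" "open (snd q)"
      using that \<A>(2) \<B>(2) by (auto simp: R_def topological_basis_open)
    then show ?thesis
      using hit measurable_sets[OF v, of "snd q"] by auto
  qed
  ultimately show ?thesis
    using \<open>countable R\<close> by (simp add: sets.countable_UN'')
qed

text \<open>The point \<open>x w\<close> moves with \<open>w\<close>, so the hit condition on
  epigraphs does not apply directly. Neighbourhoods of \<open>(x w, r)\<close> are therefore encoded
  as fixed open sets \<open>H n\<close> with \<open>x w\<close> as an additional coordinate.\<close>

lemma borel_measurable_normal_integrand:
  fixes h :: "'a::euclidean_space \<Rightarrow> 'w \<Rightarrow> ereal"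
  assumes h: "convex_normal_integrand M h" and x: "x \<in> borel_measurable M"
  shows "(\<lambda>w. h (x w) w) \<in> borel_measurable M"
proof (rule borel_measurableI_le)
  fix c :: ereal
  \<comment> \<open>By closedness, \<open>(x w, r)\<close> lies in the epigraph iff each ball around it hits the epigraph.\<close>
  have meas: "{w \<in> space M. h (x w) w \<le> ereal r} \<in> sets M" for r
  proof -
    define H where "H n = {q :: ('a \<times> real) \<times> 'a. dist (fst (fst q)) (snd q) < 1 / real (Suc n) \<and>
        dist (snd (fst q)) r < 1 / real (Suc n)}" for n
    have "open (H n)" for n
      unfolding H_def by (intro open_Collect_conj open_Collect_less continuous_intros)
    moreover have "{w \<in> space M. h (x w) w \<le> ereal r} =
        {w \<in> space M. \<forall>n. \<exists>z\<in>epi (\<lambda>\<xi>. h \<xi> w). (z, x w) \<in> H n}"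
    proof (intro Collect_cong conj_cong refl iffI allI)
      fix w n assume "h (x w) w \<le> ereal r"
      then show "\<exists>z\<in>epi (\<lambda>\<xi>. h \<xi> w). (z, x w) \<in> H n"
        by (intro bexI[of _ "(x w, r)"]) (auto simp: epi_def H_def)
    next
      fix w assume w: "w \<in> space M" and *: "\<forall>n. \<exists>z\<in>epi (\<lambda>\<xi>. h \<xi> w). (z, x w) \<in> H n"
      have "(x w, r) \<in> closure (epi (\<lambda>\<xi>. h \<xi> w))"
        unfolding closure_approachable
      proof (intro allI impI)
        fix e :: real assume "0 < e"
        \<comment> \<open>Half of \<open>e\<close>, because the distances in the point and in the
          level are added.\<close>
        then obtain n where n: "1 / real (Suc n) < e / 2"
          using nat_approx_posE[of "e / 2"] by auto
        obtain z s where z: "(z, s) \<in> epi (\<lambda>\<xi>. h \<xi> w)" "((z, s), x w) \<in> H n"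
          using * by (metis surj_pair)
        have "dist (z, s) (x w, r) \<le> dist z (x w) + dist s r"
          unfolding dist_Pair_Pair by (rule sqrt_sum_squares_le_sum) auto
        also have "\<dots> < e"
          using z(2) n by (auto simp: H_def)
        finally show "\<exists>z\<in>epi (\<lambda>\<xi>. h \<xi> w). dist z (x w, r) < e"
          using z(1) by blast
      qed
      moreover have "closed (epi (\<lambda>\<xi>. h \<xi> w))"
        using h w by (auto simp: convex_normal_integrand_def)
      ultimately show "h (x w) w \<le> ereal r"
        by (simp add: closure_closed epi_def)
    qed
    ultimately show ?thesis
      using sets_hit_open_product[of M "\<lambda>w. epi (\<lambda>\<xi>. h \<xi> w)", OF _ x] h
      by (auto simp: convex_normal_integrand_def intro!: sets.sets_Collect_countable_All)
  qed
  show "{w \<in> space M. h (x w) w \<le> c} \<in> sets M"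
  proof (cases c)
    case MInf
    \<comment> \<open>The value -\<infinity> has no real level of its own; it is reached as the
      intersection of the levels \<open>- real n\<close>.\<close>
    have "(h (x w) w \<le> c) = (\<forall>n::nat. h (x w) w \<le> ereal (- real n))" for w
    proof
      assume *: "\<forall>n::nat. h (x w) w \<le> ereal (- real n)"
      show "h (x w) w \<le> c"
      proof (cases "h (x w) w")
        case (real r)
        obtain n :: nat where "- r < real n" using reals_Archimedean2 by blast
        with *[rule_format, of n] real show ?thesis by simp
      qed (use * in auto)
    qed (use MInf in auto)
    then show ?thesis
      using meas by (simp add: sets.sets_Collect_countable_All)
  qed (use meas in auto)
qed

text \<open>Turns a strict lower bound on the conjugate into the epigraph being hit by a set that is
  open jointly in \<open>(x, r)\<close> and \<open>v\<close>, the form needed for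
  measurability.\<close>

lemma less_fenchel_conjugate_iff:
  "c < fenchel_conjugate g v \<longleftrightarrow> (\<exists>(x, r)\<in>epi g. c < ereal (x \<bullet> v - r))"
proof
  assume "c < fenchel_conjugate g v"
  then obtain x where x: "c < ereal (x \<bullet> v) - g x"
    by (auto simp: fenchel_conjugate_def less_SUP_iff)
  show "\<exists>(x, r)\<in>epi g. c < ereal (x \<bullet> v - r)"
  proof (cases "g x")
    case (real r)
    with x show ?thesis by (intro bexI[of _ "(x, r)"]) (auto simp: epi_def)
  next
    case PInf
    with x show ?thesis by simp
  next
    case MInf
    with x have "c < \<infinity>" by auto
    then obtain s where "c < ereal s" by (auto simp: less_PInf_Ex_of_nat)
    \<comment> \<open>Over such an \<open>x\<close> the epigraph contains the whole vertical line,
      so the level can be chosen to make \<open>x \<bullet> v - r\<close> equal to \<open>s\<close>,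
      which exceeds \<open>c\<close>.\<close>
    with MInf show ?thesis
      by (intro bexI[of _ "(x, x \<bullet> v - s)"]) (auto simp: epi_def)
  qed
next
  assume "\<exists>(x, r)\<in>epi g. c < ereal (x \<bullet> v - r)"
  then obtain x r where "g x \<le> ereal r" "c < ereal (x \<bullet> v - r)"
    by (auto simp: epi_def)
  moreover from this have "ereal (x \<bullet> v - r) \<le> ereal (x \<bullet> v) - g x"
    by (cases "g x") auto
  ultimately show "c < fenchel_conjugate g v"
    unfolding fenchel_conjugate_def less_SUP_iff by (metis UNIV_I order_less_le_trans)
qed

lemma borel_measurable_fenchel_conjugate:
  fixes h :: "'a::euclidean_space \<Rightarrow> 'w \<Rightarrow> ereal"
  assumes h: "convex_normal_integrand M h" and v: "v \<in> borel_measurable M"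
  shows "(\<lambda>w. fenchel_conjugate (\<lambda>\<xi>. h \<xi> w) (v w)) \<in> borel_measurable M"
proof (rule borel_measurableI_greater)
  fix c :: ereal
  define H where "H = {q :: ('a \<times> real) \<times> 'a. c < ereal (fst (fst q) \<bullet> snd q - snd (fst q))}"
  have "open H"
    unfolding H_def by (intro open_Collect_less continuous_intros)
  then have "{w \<in> space M. \<exists>z\<in>epi (\<lambda>\<xi>. h \<xi> w). (z, v w) \<in> H} \<in> sets M"
    using h by (intro sets_hit_open_product[OF _ v]) (auto simp: convex_normal_integrand_def)
  then show "{w \<in> space M. c < fenchel_conjugate (\<lambda>\<xi>. h \<xi> w) (v w)} \<in> sets M"
    by (simp add: less_fenchel_conjugate_iff H_def case_prod_unfold)
qed

section \<open>Fenchel's inequality and its equality case\<close>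

text \<open>A subgradient at \<open>x\<close> is a vector \<open>v\<close> for which the supremum
  defining the conjugate is attained at \<open>x\<close>. The upper bounds exclude infinite values,
  so that attainment can be expressed by real numbers.\<close>

lemma fenchel_young_finite:
  assumes "g x < \<infinity>" "fenchel_conjugate g v < \<infinity>"
  obtains a b where "g x = ereal a" "fenchel_conjugate g v = ereal b" "x \<bullet> v \<le> a + b"
    "v \<in> subdifferential g x \<longleftrightarrow> a + b = x \<bullet> v"
proof -
  have le: "ereal (z \<bullet> v) - g z \<le> fenchel_conjugate g v" for z
    unfolding fenchel_conjugate_def by (rule SUP_upper) simp
  \<comment> \<open>If \<open>g x\<close> were -\<infinity>, the term of the supremum at
    \<open>x\<close> would make the conjugate infinite.\<close>
  obtain a where a: "g x = ereal a"
    using assms le[of x] by (cases "g x") auto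
  obtain b where b: "fenchel_conjugate g v = ereal b"
    using assms le[of x] a by (cases "fenchel_conjugate g v") auto
  have ge: "x \<bullet> v \<le> a + b"
    using le[of x] by (simp add: a b)
  have "v \<in> subdifferential g x \<longleftrightarrow> a + b \<le> x \<bullet> v"
  proof
    assume v: "v \<in> subdifferential g x"
    have "ereal (z \<bullet> v) - g z \<le> ereal (x \<bullet> v - a)" for z
      using v[unfolded subdifferential_def, simplified, rule_format, of z] a
      by (cases "g z") (auto simp: inner_diff_right inner_commute)
    then have "fenchel_conjugate g v \<le> ereal (x \<bullet> v - a)"
      unfolding fenchel_conjugate_def by (rule SUP_least)
    then show "a + b \<le> x \<bullet> v" by (simp add: b)
  next
    assume *: "a + b \<le> x \<bullet> v"
    have "g x + ereal (v \<bullet> (z - x)) \<le> g z" for z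
      using le[of z] * by (cases "g z") (auto simp: a b inner_diff_right inner_commute)
    then show "v \<in> subdifferential g x" by (simp add: subdifferential_def)
  qed
  with a b ge that show thesis by fastforce
qed

section \<open>Pairings of adapted processes that are only bounded above\<close>

text \<open>Without the upper bound \<open>g\<close> the integrals over \<open>D k\<close> could vanish by cancellation for a
  non-integrable \<open>z\<close>; with it, monotone convergence applies to \<open>g - z\<close>.\<close>

lemma integral_zero_exhaustion:
  fixes z g :: "'w \<Rightarrow> real" and D :: "nat \<Rightarrow> 'w set"
  assumes z: "z \<in> borel_measurable M" and g: "integrable M g" and le: "AE w in M. z w \<le> g w"
    and D: "\<And>k. D k \<in> sets M" "incseq D" "(\<Union>k. D k) = space M"
    and int: "\<And>k. integrable M (\<lambda>w. indicator (D k) w * z w)"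
    and zero: "\<And>k. (\<integral>w. indicator (D k) w * z w \<partial>M) = 0"
  shows "integrable M z" "(\<integral>w. z w \<partial>M) = 0"
proof -
  have lim: "(\<lambda>k. indicator (D k) w * u) \<longlonglongrightarrow> u" if "w \<in> space M" for w and u :: real
    using tendsto_mult_right[OF LIMSEQ_indicator_incseq[OF D(2), of w], of u] that D(3) by simp
  have gint: "integrable M (\<lambda>w. indicator (D k) w * g w)" for k
    using integrable_mult_indicator[OF D(1) g, of k] by simp
  have glim: "(\<lambda>k. \<integral>w. indicator (D k) w * g w \<partial>M) \<longlonglongrightarrow> (\<integral>w. g w \<partial>M)"
  proof (rule integral_dominated_convergence[where w="\<lambda>w. \<bar>g w\<bar>"])
    show "AE w in M. norm (indicator (D k) w * g w) \<le> \<bar>g w\<bar>" for k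
      by (auto simp: indicator_def)
  qed (use g gint lim in auto)
  have dint: "integrable M (\<lambda>w. indicator (D k) w * (g w - z w))" for k
    using Bochner_Integration.integrable_diff[OF gint int, of k k] by (simp add: algebra_simps)
  \<comment> \<open>As \<open>z\<close> integrates to 0 over \<open>D k\<close>, the integrals of
    \<open>g - z\<close> over \<open>D k\<close> are those of \<open>g\<close>, whose limit is
    already known from dominated convergence.\<close>
  have deq: "(\<integral>w. indicator (D k) w * (g w - z w) \<partial>M) = (\<integral>w. indicator (D k) w * g w \<partial>M)" for k
    using Bochner_Integration.integral_diff[OF gint int, of k k] zero[of k]
    by (simp add: algebra_simps)
  have mono: "AE w in M. mono (\<lambda>k. indicator (D k) w * (g w - z w))"
    using le
  proof eventually_elim
    case (elim w)
    then show ?case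
      using D(2) by (auto simp: mono_def indicator_def)
  qed
  have pos: "AE w in M. 0 \<le> indicator (D k) w * (g w - z w)" for k
    using le by eventually_elim simp
  have lim': "AE w in M. (\<lambda>k. indicator (D k) w * (g w - z w)) \<longlonglongrightarrow> g w - z w"
    using lim by auto
  have diff: "integrable M (\<lambda>w. g w - z w)" "(\<integral>w. g w - z w \<partial>M) = (\<integral>w. g w \<partial>M)"
    using integral_monotone_convergence_nonneg[OF dint mono pos lim' glim[folded deq]] z g by auto
  show "integrable M z"
    using Bochner_Integration.integrable_diff[OF g diff(1)] by simp
  then show "(\<integral>w. z w \<partial>M) = 0"
    using diff(2) g by simp
qed

text \<open>Induction on the number of periods: after multiplication by the indicator of \<open>{\<bar>x\<^sub>s\<bar> \<le> k}\<close> the first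
  term is integrable with mean 0, so that the remaining sum again has an integrable upper bound.\<close>

lemma integral_adapted_pairing_zero:
  fixes x v :: "nat \<Rightarrow> 'w \<Rightarrow> 'a::euclidean_space"
  assumes "\<And>t. t \<in> {s..<s + n} \<Longrightarrow> subalgebra M (F t)"
    and "\<And>t u. s \<le> t \<Longrightarrow> t \<le> u \<Longrightarrow> u < s + n \<Longrightarrow> sets (F t) \<subseteq> sets (F u)"
    and "\<And>t. t \<in> {s..<s + n} \<Longrightarrow> x t \<in> borel_measurable (F t)"
    and "\<And>t. t \<in> {s..<s + n} \<Longrightarrow> integrable M (v t)"
    and "\<And>t b c. t \<in> {s..<s + n} \<Longrightarrow> b \<in> borel_measurable (F t) \<Longrightarrow>
          (\<And>w. w \<in> space M \<Longrightarrow> norm (b w) \<le> c) \<Longrightarrow> (\<integral>w. b w \<bullet> v t w \<partial>M) = 0"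
    and "integrable M g" and "AE w in M. (\<Sum>t=s..<s + n. x t w \<bullet> v t w) \<le> g w"
  shows "integrable M (\<lambda>w. \<Sum>t=s..<s + n. x t w \<bullet> v t w) \<and>
    (\<integral>w. (\<Sum>t=s..<s + n. x t w \<bullet> v t w) \<partial>M) = 0"
  using assms
proof (induction n arbitrary: s x g)
  case (Suc n)
  note sub = Suc.prems(1) and filt = Suc.prems(2) and x = Suc.prems(3) and v = Suc.prems(4)
    and orth = Suc.prems(5) and g = Suc.prems(6) and le = Suc.prems(7)
  define r where "r w = (\<Sum>t=Suc s..<Suc s + n. x t w \<bullet> v t w)" for w
  have split: "(\<Sum>t=s..<s + Suc n. x t w \<bullet> v t w) = x s w \<bullet> v s w + r w" for w
    unfolding r_def by (simp add: sum.atLeast_Suc_lessThan)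
  have xM: "x t \<in> borel_measurable M" if "t \<in> {s..<s + Suc n}" for t
    using measurable_from_subalg[OF sub x] that by blast
  have vM: "v t \<in> borel_measurable M" if "t \<in> {s..<s + Suc n}" for t
    using v[OF that] by auto
  \<comment> \<open>The cut-off depends on \<open>x s\<close> alone. By monotonicity of the
    filtration \<open>D k\<close> also belongs to every later \<open>F t\<close>, so multiplying
    later terms by its indicator keeps them adapted.\<close>
  define D where "D k = {w \<in> space M. norm (x s w) \<le> real k}" for k :: nat
  have spF: "space (F t) = space M" if "t \<in> {s..<s + Suc n}" for t
    using sub[OF that] by (simp add: subalgebra_def)
  have DF: "D k \<in> sets (F t)" if "t \<in> {s..<s + Suc n}" for k t
  proof -
    have "{w \<in> space (F s). norm (x s w) \<le> real k} \<in> sets (F s)"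
      using x[of s] by measurable
    then show ?thesis
      using filt[of s t] that spF[of s] by (auto simp: D_def)
  qed
  have DM: "D k \<in> sets M" for k
    using DF[of s k] sub[of s] by (auto simp: subalgebra_def)
  have xD: "(\<lambda>w. indicator (D k) w *\<^sub>R x t w) \<in> borel_measurable (F t)"
    if "t \<in> {s..<s + Suc n}" for k t
    using DF[OF that] x[OF that] by measurable
  have bnd: "norm (indicator (D k) w *\<^sub>R x s w) \<le> real k" for k w
    by (auto simp: D_def indicator_def)
  have bnd': "\<bar>indicator (D k) w * (x s w \<bullet> v s w)\<bar> \<le> real k * norm (v s w)" for k w
  proof -
    have "\<bar>(indicator (D k) w *\<^sub>R x s w) \<bullet> v s w\<bar> \<le> norm (indicator (D k) w *\<^sub>R x s w) * norm (v s w)"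
      by (rule Cauchy_Schwarz_ineq2)
    also have "\<dots> \<le> real k * norm (v s w)"
      by (rule mult_right_mono[OF bnd]) simp
    finally show ?thesis by simp
  qed
  have first: "integrable M (\<lambda>w. indicator (D k) w * (x s w \<bullet> v s w))"
      "(\<integral>w. indicator (D k) w * (x s w \<bullet> v s w) \<partial>M) = 0" for k
  proof -
    show "integrable M (\<lambda>w. indicator (D k) w * (x s w \<bullet> v s w))"
    proof (rule Bochner_Integration.integrable_bound)
      show "integrable M (\<lambda>w. real k * norm (v s w))"
        using v[of s] by auto
      show "(\<lambda>w. indicator (D k) w * (x s w \<bullet> v s w)) \<in> borel_measurable M"
        using DM xM[of s] vM[of s] by simp
    qed (use bnd' in auto)
    \<comment> \<open>The cut-off of \<open>x s\<close> is bounded and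
      \<open>F s\<close>-measurable, hence an admissible test variable in
      \<open>orth\<close>.\<close>
    show "(\<integral>w. indicator (D k) w * (x s w \<bullet> v s w) \<partial>M) = 0"
      using orth[of s "\<lambda>w. indicator (D k) w *\<^sub>R x s w" "real k", OF _ xD bnd] by simp
  qed
  have rest: "integrable M (\<lambda>w. indicator (D k) w * r w) \<and> (\<integral>w. indicator (D k) w * r w \<partial>M) = 0" for k
  proof -
    have eq: "indicator (D k) w * r w =
        (\<Sum>t=Suc s..<Suc s + n. (indicator (D k) w *\<^sub>R x t w) \<bullet> v t w)" for w
      by (simp only: r_def sum_distrib_left inner_scaleR_left)
    show ?thesis
      unfolding eq
    proof (rule Suc.IH)
      \<comment> \<open>The term at time \<open>s\<close> is moved to the right at the cost
        \<open>real k * norm (v s w)\<close>. The absolute value of \<open>g\<close> is taken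
        because outside \<open>D k\<close> the remaining sum is 0 while \<open>g\<close> may be
        negative.\<close>
      show "integrable M (\<lambda>w. \<bar>g w\<bar> + real k * norm (v s w))"
        using g v[of s] by auto
      show "AE w in M. (\<Sum>t=Suc s..<Suc s + n. (indicator (D k) w *\<^sub>R x t w) \<bullet> v t w)
          \<le> \<bar>g w\<bar> + real k * norm (v s w)"
        using le
      proof eventually_elim
        case (elim w)
        then have "indicator (D k) w * (x s w \<bullet> v s w) + indicator (D k) w * r w \<le> \<bar>g w\<bar>"
          unfolding split by (auto simp: indicator_def)
        then show ?case
          unfolding eq[symmetric] using bnd'[of k w] by linarith
      qed
      show "(\<integral>w. b w \<bullet> v t w \<partial>M) = 0"
        if "t \<in> {Suc s..<Suc s + n}" "b \<in> borel_measurable (F t)"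
          "\<And>w. w \<in> space M \<Longrightarrow> norm (b w) \<le> c" for t b c
        using orth[of t b c] that by simp
    qed (use sub filt xD v in auto)
  qed
  have inc: "incseq D" by (auto simp: D_def incseq_def)
  have union: "(\<Union>k. D k) = space M"
    by (auto simp: D_def intro: real_arch_simple)
  have int: "integrable M (\<lambda>w. indicator (D k) w * (x s w \<bullet> v s w + r w))"
    and zero: "(\<integral>w. indicator (D k) w * (x s w \<bullet> v s w + r w) \<partial>M) = 0" for k
    using first[of k] rest[of k] by (simp_all add: distrib_left)
  have meas: "(\<lambda>w. x s w \<bullet> v s w + r w) \<in> borel_measurable M"
    unfolding r_def using xM vM
    by (auto intro!: borel_measurable_add borel_measurable_sum borel_measurable_inner)
  have "AE w in M. x s w \<bullet> v s w + r w \<le> g w"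
    using le by (simp only: split)
  then have "integrable M (\<lambda>w. x s w \<bullet> v s w + r w)" "(\<integral>w. x s w \<bullet> v s w + r w \<partial>M) = 0"
    using integral_zero_exhaustion[OF meas g _ DM inc union int zero] by blast+
  then show ?case
    by (simp only: split)
qed simp

section \<open>Expectations of extended real-valued functions\<close>

text \<open>The bound is the positive part: \<open>e2ennreal\<close> truncates at 0, and a finite
  integral makes the result finite almost everywhere.\<close>

lemma ext_expectation_upper_bound:
  assumes G: "G \<in> borel_measurable M" and fin: "ext_expectation M G < \<infinity>"
  obtains g where "integrable M g" "AE w in M. G w \<le> ereal (g w)"
proof -
  have P: "(\<integral>\<^sup>+ w. e2ennreal (G w) \<partial>M) \<noteq> \<infinity>"
    using fin by (auto simp: ext_expectation_def)
  have AE: "AE w in M. e2ennreal (G w) \<noteq> \<infinity>"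
    using nn_integral_noteq_infinite[OF _ P] G by simp
  show thesis
  proof (rule that[of "\<lambda>w. enn2real (e2ennreal (G w))"])
    have "(\<integral>\<^sup>+ w. ennreal (enn2real (e2ennreal (G w))) \<partial>M) = (\<integral>\<^sup>+ w. e2ennreal (G w) \<partial>M)"
      using AE by (intro nn_integral_cong_AE) (auto simp: ennreal_enn2real_if)
    then show "integrable M (\<lambda>w. enn2real (e2ennreal (G w)))"
      using P G by (intro integrableI_nonneg) (auto simp: less_top)
    show "AE w in M. G w \<le> ereal (enn2real (e2ennreal (G w)))"
      using AE
    proof eventually_elim
      case (elim w)
      have "G w \<le> enn2ereal (e2ennreal (G w))"
        by (cases "0 \<le> G w") (auto simp: enn2ereal_e2ennreal intro: order_trans[OF _ enn2ereal_nonneg])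
      also have "\<dots> = ereal (enn2real (e2ennreal (G w)))"
        using elim by (cases "e2ennreal (G w)") auto
      finally show ?case .
    qed
  qed
qed

text \<open>Both the positive and the negative part have finite integral, so the definition reduces
  to an ordinary difference of reals.\<close>

lemma ext_expectation_eq_integral:
  assumes g: "integrable M g" and eq: "AE w in M. G w = ereal (g w)"
  shows "ext_expectation M G = ereal (\<integral>w. g w \<partial>M)"
proof -
  have pos: "(\<integral>\<^sup>+ w. e2ennreal (G w) \<partial>M) = (\<integral>\<^sup>+ w. ennreal (g w) \<partial>M)"
    using eq by (intro nn_integral_cong_AE) (auto simp: ennreal_def)
  have neg: "(\<integral>\<^sup>+ w. e2ennreal (- G w) \<partial>M) = (\<integral>\<^sup>+ w. ennreal (- g w) \<partial>M)"
    using eq by (intro nn_integral_cong_AE) (auto simp: ennreal_def)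
  have "(\<integral>\<^sup>+ w. ennreal (g w) \<partial>M) \<noteq> \<infinity>" "(\<integral>\<^sup>+ w. ennreal (- g w) \<partial>M) \<noteq> \<infinity>"
    using g by (auto simp: real_integrable_def)
  moreover have "(\<integral>w. g w \<partial>M) = enn2real (\<integral>\<^sup>+ w. ennreal (g w) \<partial>M) - enn2real (\<integral>\<^sup>+ w. ennreal (- g w) \<partial>M)"
    by (rule real_lebesgue_integral_def[OF g])
  ultimately show ?thesis
    unfolding ext_expectation_def pos neg
    by (cases "\<integral>\<^sup>+ w. ennreal (g w) \<partial>M"; cases "\<integral>\<^sup>+ w. ennreal (- g w) \<partial>M") auto
qed

section \<open>Orthogonality to the adapted processes\<close>

lemma ess_bounded_in_space:
  assumes S: "solid_decomposable_space M S" and u: "u \<in> ess_bounded M"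
  shows "u \<in> S"
proof -
  have "decomposable M S" "(\<lambda>_. 0) \<in> S"
    using S by (simp_all add: solid_decomposable_space_def random_linear_space_def)
  \<comment> \<open>Gluing on the empty set leaves only the essentially bounded function.\<close>
  from this(1)[unfolded decomposable_def, rule_format, OF this(2) u sets.empty_sets]
  show ?thesis by simp
qed

text \<open>Constants belong to \<open>S\<close> and \<open>C\<close>, so the duality makes every
  coordinate of \<open>p t\<close> integrable.\<close>

lemma integrable_dual_process:
  assumes S: "solid_decomposable_space M S" and C: "solid_decomposable_space M C"
    and SS: "separating_duality M S S'" and CC: "separating_duality M C C'"
    and p: "p \<in> pair_processes T S' C'" and t: "t \<le> T"
  shows "integrable M (p t)"
proof -
  have const: "(\<lambda>_. u) \<in> ess_bounded M" for u :: "real^'k"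
    by (auto simp: ess_bounded_def)
  have "integrable M (\<lambda>w. p t w \<bullet> e)" for e
  proof -
    have "integrable M (\<lambda>w. fst e \<bullet> fst (p t w))" "integrable M (\<lambda>w. snd e \<bullet> snd (p t w))"
      using p t ess_bounded_in_space[OF S const[of "fst e"]]
        ess_bounded_in_space[OF C const[of "snd e"]] SS CC
      by (auto simp: pair_processes_def separating_duality_def)
    then show ?thesis
      by (simp add: inner_prod_def inner_commute)
  qed
  then have "integrable M (\<lambda>w. \<Sum>e\<in>Basis. (p t w \<bullet> e) *\<^sub>R e)"
    by (intro Bochner_Integration.integrable_sum integrable_scaleR_left) auto
  then show ?thesis
    by (simp add: euclidean_representation)
qed

lemma adapted_perp_orthogonal:
  assumes S: "solid_decomposable_space M S" and C: "solid_decomposable_space M C"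
    and p: "p \<in> adapted_perp M T F S S' C C'" and t: "t \<le> T"
    and sub: "subalgebra M (F t)" and b: "b \<in> borel_measurable (F t)"
    and bnd: "\<And>w. w \<in> space M \<Longrightarrow> norm (b w) \<le> c"
  shows "(\<integral>w. b w \<bullet> p t w \<partial>M) = 0"
proof -
  \<comment> \<open>The test process is \<open>b\<close> at time \<open>t\<close> and 0 at all
    others, which isolates a single term of the pairing.\<close>
  define x where "x s = (if s = t then b else (\<lambda>_. 0))" for s
  have bM: "b \<in> borel_measurable M"
    using measurable_from_subalg[OF sub b] .
  have "(\<lambda>w. fst (b w)) \<in> borel_measurable M" "(\<lambda>w. snd (b w)) \<in> borel_measurable M"
    by (auto intro!: measurable_compose[OF bM] borel_measurable_continuous_onI continuous_intros)
  moreover have le: "norm (fst (b w)) \<le> c" "norm (snd (b w)) \<le> c" if "w \<in> space M" for w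
    using bnd[OF that] norm_fst_le[of "fst (b w)" "snd (b w)"] norm_snd_le[of "snd (b w)" "fst (b w)"]
    by auto
  ultimately have "(\<lambda>w. fst (b w)) \<in> ess_bounded M" "(\<lambda>w. snd (b w)) \<in> ess_bounded M"
    using le by (auto simp: ess_bounded_def intro!: exI[of _ c] AE_I2)
  then have "x \<in> pair_processes T S C"
    using S C ess_bounded_in_space[OF S] ess_bounded_in_space[OF C]
    by (auto simp: pair_processes_def x_def solid_decomposable_space_def random_linear_space_def)
  moreover have "x \<in> adapted_processes T F"
    using b by (auto simp: adapted_processes_def x_def)
  ultimately have "(\<integral>w. (\<Sum>s\<le>T. x s w \<bullet> p s w) \<partial>M) = 0"
    using p by (auto simp: adapted_perp_def)
  moreover have "(\<Sum>s\<le>T. x s w \<bullet> p s w) = b w \<bullet> p t w" for w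
  proof -
    have "(\<Sum>s\<le>T. x s w \<bullet> p s w) = (\<Sum>s\<le>T. if s = t then b w \<bullet> p t w else 0)"
      by (intro sum.cong) (auto simp: x_def)
    then show ?thesis using t by simp
  qed
  ultimately show ?thesis by simp
qed

lemma integral_adapted_perp_zero:
  assumes S: "solid_decomposable_space M S" and C: "solid_decomposable_space M C"
    and SS: "separating_duality M S S'" and CC: "separating_duality M C C'"
    and F: "finite_filtration M T F"
    and p: "p \<in> adapted_perp M T F S S' C C'" and x: "x \<in> adapted_processes T F"
    and g: "integrable M g" and le: "AE w in M. (\<Sum>t\<le>T. x t w \<bullet> p t w) \<le> g w"
  shows "integrable M (\<lambda>w. \<Sum>t\<le>T. x t w \<bullet> p t w)" "(\<integral>w. (\<Sum>t\<le>T. x t w \<bullet> p t w) \<partial>M) = 0"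
proof -
  \<comment> \<open>Times 0 to \<open>T\<close> are \<open>Suc T\<close> periods starting at
    \<open>s = 0\<close>, the form in which the induction was carried out.\<close>
  have eq: "{..T} = {0..<0 + Suc T}" by auto
  have pp: "p \<in> pair_processes T S' C'" using p by (simp add: adapted_perp_def)
  have "integrable M (\<lambda>w. \<Sum>t=0..<0 + Suc T. x t w \<bullet> p t w) \<and>
      (\<integral>w. (\<Sum>t=0..<0 + Suc T. x t w \<bullet> p t w) \<partial>M) = 0"
  proof (rule integral_adapted_pairing_zero[where F=F])
    show "AE w in M. (\<Sum>t=0..<0 + Suc T. x t w \<bullet> p t w) \<le> g w"
      using le unfolding eq .
    show "integrable M (p t)" if "t \<in> {0..<0 + Suc T}" for t
      using integrable_dual_process[OF S C SS CC pp] that by simp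
    show "(\<integral>w. b w \<bullet> p t w \<partial>M) = 0"
      if "t \<in> {0..<0 + Suc T}" "b \<in> borel_measurable (F t)"
        "\<And>w. w \<in> space M \<Longrightarrow> norm (b w) \<le> c" for t b c
      using adapted_perp_orthogonal[OF S C p _ _ that(2,3)] that(1) F
      by (simp add: finite_filtration_def)
  qed (use F x g in \<open>auto simp: finite_filtration_def adapted_processes_def\<close>)
  then show "integrable M (\<lambda>w. \<Sum>t\<le>T. x t w \<bullet> p t w)" "(\<integral>w. (\<Sum>t\<le>T. x t w \<bullet> p t w) \<partial>M) = 0"
    unfolding eq by blast+
qed

section \<open>Pointwise summation along the system equations\<close>

lemma sum_inner_dual_arg:
  assumes sys: "\<forall>t\<in>{1..T}. system_equation A B W x t w"
  shows "(\<Sum>t\<le>T. x t w \<bullet> dual_arg T A B p y t w) =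
    (\<Sum>t\<le>T. x t w \<bullet> p t w) + (\<Sum>t=1..T. W t w \<bullet> y t w)"
proof -
  define Z where "Z t = zero_ext T y t w" for t
  \<comment> \<open>\<open>f t\<close> pairs \<open>y t\<close> with the state at \<open>t\<close>
    that the system would reach without the disturbance \<open>W t\<close>; moving the transposes to
    the other factor produces it one step ahead, as \<open>f (Suc t)\<close>.\<close>
  define f where "f t = (fst (x (t - 1) w) + zero_ext T A t w *v fst (x (t - 1) w)
      + zero_ext T B t w *v snd (x (t - 1) w)) \<bullet> Z t" for t
  have adj: "a \<bullet> (transpose Q *v z) = (Q *v a) \<bullet> z" for a z and Q :: "real^'k^'l"
    by (metis dot_lmul_matrix inner_commute transpose_matrix_vector)
  have summand: "x t w \<bullet> dual_arg T A B p y t w = x t w \<bullet> p t w - f (Suc t) + fst (x t w) \<bullet> Z t" for t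
    by (cases "x t w") (simp add: dual_arg_def f_def Z_def inner_diff_right inner_add_right inner_add_left adj
        inner_diff_left del: transpose_matrix_vector)
  have "(\<Sum>t\<le>T. f (Suc t)) = (\<Sum>t=1..Suc T. f t)"
    using sum.atLeast_Suc_atMost_Suc_shift[of f 0 T] by (simp add: atLeast0AtMost)
  \<comment> \<open>The last term vanishes by the convention that \<open>y\<close> is 0 at
    \<open>T + 1\<close>.\<close>
  also have "\<dots> = (\<Sum>t=1..T. f t)"
    by (simp add: f_def Z_def zero_ext_def)
  finally have 1: "(\<Sum>t\<le>T. f (Suc t)) = (\<Sum>t=1..T. f t)" .
  \<comment> \<open>Here the convention that \<open>y\<close> is 0 at time 0 removes the first
    term.\<close>
  have 2: "(\<Sum>t\<le>T. fst (x t w) \<bullet> Z t) = (\<Sum>t=1..T. fst (x t w) \<bullet> Z t)"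
    by (intro sum.mono_neutral_right) (auto simp: Z_def zero_ext_def)
  have "(\<Sum>t=1..T. fst (x t w) \<bullet> Z t) - (\<Sum>t=1..T. f t) = (\<Sum>t=1..T. W t w \<bullet> y t w)"
    unfolding sum_subtractf[symmetric]
  proof (rule sum.cong)
    fix t assume t: "t \<in> {1..T}"
    then have "fst (x t w) = fst (x (t - 1) w) + A t w *v fst (x (t - 1) w)
        + B t w *v snd (x (t - 1) w) + W t w"
      using sys by (auto simp: system_equation_def algebra_simps)
    with t show "fst (x t w) \<bullet> Z t - f t = W t w \<bullet> y t w"
      by (simp add: f_def Z_def zero_ext_def inner_add_left)
  qed simp
  then show ?thesis
    by (simp add: summand sum.distrib sum_subtractf 1 2)
qed

text \<open>The Fenchel gaps of the summands are nonnegative, so their sum vanishes only if each of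
  them does.\<close>

lemma fenchel_young_sum:
  assumes "(\<Sum>t\<in>I. f t (\<xi> t)) < \<infinity>" "(\<Sum>t\<in>I. fenchel_conjugate (f t) (v t)) < \<infinity>" "finite I"
  obtains a b where "(\<Sum>t\<in>I. f t (\<xi> t)) = ereal a"
    "(\<Sum>t\<in>I. fenchel_conjugate (f t) (v t)) = ereal b"
    "(\<Sum>t\<in>I. \<xi> t \<bullet> v t) \<le> a + b"
    "(\<forall>t\<in>I. v t \<in> subdifferential (f t) (\<xi> t)) \<longleftrightarrow> a + b = (\<Sum>t\<in>I. \<xi> t \<bullet> v t)"
proof -
  have "\<forall>t\<in>I. \<exists>a b. f t (\<xi> t) = ereal a \<and> fenchel_conjugate (f t) (v t) = ereal b \<and>
      \<xi> t \<bullet> v t \<le> a + b \<and> (v t \<in> subdifferential (f t) (\<xi> t) \<longleftrightarrow> a + b = \<xi> t \<bullet> v t)"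
  proof
    fix t assume "t \<in> I"
    \<comment> \<open>A single summand \<infinity> makes the whole sum \<infinity>, even in the
      presence of a summand -\<infinity>.\<close>
    then have "f t (\<xi> t) < \<infinity>" "fenchel_conjugate (f t) (v t) < \<infinity>"
      using assms by (force simp: less_top[symmetric] sum_Pinfty top_ereal_def)+
    then show "\<exists>a b. f t (\<xi> t) = ereal a \<and> fenchel_conjugate (f t) (v t) = ereal b \<and>
        \<xi> t \<bullet> v t \<le> a + b \<and> (v t \<in> subdifferential (f t) (\<xi> t) \<longleftrightarrow> a + b = \<xi> t \<bullet> v t)"
      by (rule fenchel_young_finite) blast
  qed
  then obtain a b where ab: "\<And>t. t \<in> I \<Longrightarrow> f t (\<xi> t) = ereal (a t)"
      "\<And>t. t \<in> I \<Longrightarrow> fenchel_conjugate (f t) (v t) = ereal (b t)"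
      "\<And>t. t \<in> I \<Longrightarrow> \<xi> t \<bullet> v t \<le> a t + b t"
      "\<And>t. t \<in> I \<Longrightarrow> v t \<in> subdifferential (f t) (\<xi> t) \<longleftrightarrow> a t + b t = \<xi> t \<bullet> v t"
    by metis
  show thesis
  proof (rule that[of "sum a I" "sum b I"])
    show "(\<Sum>t\<in>I. \<xi> t \<bullet> v t) \<le> sum a I + sum b I"
      unfolding sum.distrib[symmetric] by (rule sum_mono[OF ab(3)])
    have "sum a I + sum b I = (\<Sum>t\<in>I. \<xi> t \<bullet> v t) \<longleftrightarrow>
        (\<Sum>t\<in>I. a t + b t - \<xi> t \<bullet> v t) = 0"
      by (simp add: sum.distrib sum_subtractf)
    also have "\<dots> \<longleftrightarrow> (\<forall>t\<in>I. a t + b t - \<xi> t \<bullet> v t = 0)"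
      using assms(3) ab(3) by (intro sum_nonneg_eq_0_iff) auto
    also have "\<dots> \<longleftrightarrow> (\<forall>t\<in>I. v t \<in> subdifferential (f t) (\<xi> t))"
      using ab(4) by auto
    finally show "(\<forall>t\<in>I. v t \<in> subdifferential (f t) (\<xi> t)) \<longleftrightarrow>
        sum a I + sum b I = (\<Sum>t\<in>I. \<xi> t \<bullet> v t)" by simp
  qed (simp_all add: ab(1,2))
qed

section \<open>Measurability of the conjugate's argument\<close>

lemma borel_measurable_transpose_mult:
  fixes Q :: "'w \<Rightarrow> real^'k^'l"
  assumes "Q \<in> borel_measurable M" "z \<in> borel_measurable M"
  shows "(\<lambda>w. transpose (Q w) *v z w) \<in> borel_measurable M"
  using assms
  by (rule borel_measurable_continuous_Pair)
    (auto simp: transpose_def matrix_vector_mult_def intro!: continuous_intros)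

lemma borel_measurable_dual_arg:
  assumes A: "\<forall>t\<in>{1..T}. A t \<in> borel_measurable M" and B: "\<forall>t\<in>{1..T}. B t \<in> borel_measurable M"
    and p: "p t \<in> borel_measurable M" and y: "\<forall>t\<in>{1..T}. y t \<in> borel_measurable M"
  shows "dual_arg T A B p y t \<in> borel_measurable M"
proof -
  have zero_ext: "zero_ext T q s \<in> borel_measurable M" if "\<forall>t\<in>{1..T}. q t \<in> borel_measurable M"
    for q :: "nat \<Rightarrow> 'a \<Rightarrow> 'e::real_normed_vector" and s
    using that by (cases "s \<in> {1..T}") (auto simp: zero_ext_def[abs_def])
  show ?thesis
    unfolding dual_arg_def[abs_def]
    by (intro borel_measurable_diff borel_measurable_Pair borel_measurable_add
        borel_measurable_transpose_mult zero_ext A B p y)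
qed

section \<open>Weak duality and its equality case\<close>

text \<open>Both objectives turn out to be finite at feasible points, so their difference is an
  ordinary integral, namely that of the nonnegative pointwise Fenchel gap.\<close>

lemma weak_duality:
  assumes F: "finite_filtration M T F"
    and S: "solid_decomposable_space M S" and S': "solid_decomposable_space M S'"
    and SS: "separating_duality M S S'"
    and C: "solid_decomposable_space M C" and CC: "separating_duality M C C'"
    and A: "\<forall>t\<in>{1..T}. A t \<in> borel_measurable (F t)"
    and B: "\<forall>t\<in>{1..T}. B t \<in> borel_measurable (F t)"
    and W: "W \<in> state_processes T S"
    and L: "\<forall>t\<le>T. convex_normal_integrand M (L t)"
    and x: "oc_feasible M T F A B W L x" and py: "dual_feasible M T F S S' C C' A B L p y"
  shows "dual_objective M T A B W L p y \<le> oc_objective M T L x"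
    and "dual_objective M T A B W L p y = oc_objective M T L x \<longleftrightarrow>
      (AE w in M. \<forall>t\<le>T. dual_arg T A B p y t w \<in> subdifferential (\<lambda>\<xi>. L t \<xi> w) (x t w))"
proof -
  let ?v = "dual_arg T A B p y"
  define G where "G w = (\<Sum>t\<le>T. L t (x t w) w)" for w
  define H where "H w = (\<Sum>t\<le>T. fenchel_conjugate (\<lambda>\<xi>. L t \<xi> w) (?v t w))" for w
  define c where "c w = (\<Sum>t=1..T. W t w \<bullet> y t w)" for w
  define z where "z w = (\<Sum>t\<le>T. x t w \<bullet> p t w)" for w
  define rG where "rG w = real_of_ereal (G w)" for w
  define rH where "rH w = real_of_ereal (H w)" for w
  have xad: "x \<in> adapted_processes T F" and sys: "AE w in M. \<forall>t\<in>{1..T}. system_equation A B W x t w"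
    and Gfin: "ext_expectation M G < \<infinity>"
    using x by (auto simp: oc_feasible_def oc_constraint_set_def oc_objective_def G_def[abs_def])
  have pp: "p \<in> adapted_perp M T F S S' C C'" and y: "\<forall>t\<in>{1..T}. y t \<in> S'"
    and Hfin: "ext_expectation M H < \<infinity>"
    using py by (auto simp: dual_feasible_def dual_constraint_set_def state_processes_def
        conj_cost_def H_def[abs_def])
  have FM: "q \<in> borel_measurable M" if "t \<le> T" "q \<in> borel_measurable (F t)"
    for t and q :: "'a \<Rightarrow> 'e::topological_space"
    using F that by (auto simp: finite_filtration_def intro: measurable_from_subalg)
  have pM: "integrable M (p t)" if "t \<le> T" for t
    using integrable_dual_process[OF S C SS CC _ that] pp by (simp add: adapted_perp_def)
  have GM: "G \<in> borel_measurable M"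
    unfolding G_def[abs_def] using L xad FM
    by (intro borel_measurable_ereal_sum borel_measurable_normal_integrand)
      (auto simp: adapted_processes_def)
  have yM: "\<forall>t\<in>{1..T}. y t \<in> borel_measurable M"
    using y S' by (auto simp: solid_decomposable_space_def random_linear_space_def)
  have AM: "\<forall>t\<in>{1..T}. A t \<in> borel_measurable M" and BM: "\<forall>t\<in>{1..T}. B t \<in> borel_measurable M"
    using FM[OF _ A[rule_format]] FM[OF _ B[rule_format]] by auto
  have vM: "?v t \<in> borel_measurable M" if "t \<le> T" for t
    using AM BM pM that yM by (intro borel_measurable_dual_arg) auto
  have HM: "H \<in> borel_measurable M"
    unfolding H_def[abs_def] using L vM
    by (intro borel_measurable_ereal_sum borel_measurable_fenchel_conjugate) auto
  have c: "integrable M c"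
    unfolding c_def[abs_def] using W y SS
    by (intro Bochner_Integration.integrable_sum) (auto simp: state_processes_def separating_duality_def)
  obtain g where g: "integrable M g" "AE w in M. G w \<le> ereal (g w)"
    using ext_expectation_upper_bound[OF GM Gfin] .
  obtain h where h: "integrable M h" "AE w in M. H w \<le> ereal (h w)"
    using ext_expectation_upper_bound[OF HM Hfin] .
  have AE: "AE w in M. G w = ereal (rG w) \<and> H w = ereal (rH w) \<and> rG w \<le> g w \<and> rH w \<le> h w \<and>
      z w + c w \<le> rG w + rH w \<and>
      ((\<forall>t\<le>T. ?v t w \<in> subdifferential (\<lambda>\<xi>. L t \<xi> w) (x t w)) \<longleftrightarrow> rG w + rH w = z w + c w)"
    using g(2) h(2) sys
  proof eventually_elim
    case (elim w)
    have "G w < \<infinity>" "H w < \<infinity>"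
      using elim(1,2) by auto
    then obtain a b where "G w = ereal a" "H w = ereal b"
      "(\<Sum>t\<le>T. x t w \<bullet> ?v t w) \<le> a + b"
      "(\<forall>t\<in>{..T}. ?v t w \<in> subdifferential (\<lambda>\<xi>. L t \<xi> w) (x t w)) \<longleftrightarrow> a + b = (\<Sum>t\<le>T. x t w \<bullet> ?v t w)"
      using fenchel_young_sum[of "\<lambda>t \<xi>. L t \<xi> w" "\<lambda>t. x t w" "{..T}" "\<lambda>t. ?v t w"]
      unfolding G_def H_def by auto
    with elim(1,2) show ?case
      unfolding sum_inner_dual_arg[OF elim(3)] by (auto simp: rG_def rH_def z_def c_def)
  qed
  have z: "integrable M z" "(\<integral>w. z w \<partial>M) = 0"
  proof -
    \<comment> \<open>Upper bounds on the two costs alone yield an integrable majorant of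
      \<open>z\<close>, through \<open>z + c \<le> rG + rH \<le> g + h\<close>.\<close>
    have "integrable M (\<lambda>w. g w + h w - c w)"
      using g h c by auto
    moreover have "AE w in M. z w \<le> g w + h w - c w"
      using AE by eventually_elim auto
    ultimately show "integrable M z" "(\<integral>w. z w \<partial>M) = 0"
      using integral_adapted_perp_zero[OF S C SS CC F pp xad] unfolding z_def by auto
  qed
  \<comment> \<open>Once \<open>z\<close> is integrable, lower bounds follow as well:
    \<open>rG \<ge> z + c - h\<close> and \<open>rH \<ge> z + c - g\<close> almost everywhere. One
    dominating function serves both costs.\<close>
  have bound: "integrable M (\<lambda>w. \<bar>z w\<bar> + \<bar>c w\<bar> + \<bar>g w\<bar> + \<bar>h w\<bar>)"
    using z c g h by auto
  have rG: "integrable M rG"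
  proof (rule Bochner_Integration.integrable_bound[OF bound])
    show "AE w in M. norm (rG w) \<le> norm (\<bar>z w\<bar> + \<bar>c w\<bar> + \<bar>g w\<bar> + \<bar>h w\<bar>)"
      using AE by eventually_elim auto
  qed (use GM in \<open>simp add: rG_def[abs_def]\<close>)
  have rH: "integrable M rH"
  proof (rule Bochner_Integration.integrable_bound[OF bound])
    show "AE w in M. norm (rH w) \<le> norm (\<bar>z w\<bar> + \<bar>c w\<bar> + \<bar>g w\<bar> + \<bar>h w\<bar>)"
      using AE by eventually_elim auto
  qed (use HM in \<open>simp add: rH_def[abs_def]\<close>)
  have "AE w in M. G w = ereal (rG w)" "AE w in M. H w = ereal (rH w)"
    using AE by auto
  then have primal: "oc_objective M T L x = ereal (\<integral>w. rG w \<partial>M)"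
    and "conj_cost M T A B L p y = ereal (\<integral>w. rH w \<partial>M)"
    using ext_expectation_eq_integral[OF rG] ext_expectation_eq_integral[OF rH]
    by (simp_all add: oc_objective_def conj_cost_def G_def[abs_def] H_def[abs_def])
  then have dual: "dual_objective M T A B W L p y = ereal ((\<integral>w. c w \<partial>M) - (\<integral>w. rH w \<partial>M))"
    by (simp add: dual_objective_def c_def)
  \<comment> \<open>As \<open>z\<close> has integral 0, the integral of \<open>gap\<close> is the
    primal minus the dual objective.\<close>
  define gap where "gap w = rG w + rH w - z w - c w" for w
  have gap: "integrable M gap"
    "(\<integral>w. gap w \<partial>M) = (\<integral>w. rG w \<partial>M) - ((\<integral>w. c w \<partial>M) - (\<integral>w. rH w \<partial>M))"
    unfolding gap_def using rG rH z c by simp_all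
  have gap_nonneg: "AE w in M. 0 \<le> gap w"
    using AE by eventually_elim (auto simp: gap_def)
  show "dual_objective M T A B W L p y \<le> oc_objective M T L x"
    using integral_nonneg_AE[OF gap_nonneg] gap by (simp add: primal dual)
  have "dual_objective M T A B W L p y = oc_objective M T L x \<longleftrightarrow> (\<integral>w. gap w \<partial>M) = 0"
    using gap by (auto simp: primal dual)
  also have "\<dots> \<longleftrightarrow> (AE w in M. gap w = 0)"
    by (rule integral_nonneg_eq_0_iff_AE[OF gap(1) gap_nonneg])
  also have "\<dots> \<longleftrightarrow> (AE w in M. \<forall>t\<le>T. ?v t w \<in> subdifferential (\<lambda>\<xi>. L t \<xi> w) (x t w))"
    using AE by (intro AE_cong_simp eventually_subst) (auto simp: gap_def elim: eventually_mono)
  finally show "dual_objective M T A B W L p y = oc_objective M T L x \<longleftrightarrow>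
      (AE w in M. \<forall>t\<le>T. ?v t w \<in> subdifferential (\<lambda>\<xi>. L t \<xi> w) (x t w))" .
qed

section \<open>Optimality through equality of the objectives\<close>

theorem theorem41:
  fixes M :: "'w measure" and T :: nat and F :: "nat \<Rightarrow> 'w measure"
    and S S' :: "('w \<Rightarrow> real^'n) set" and C C' :: "('w \<Rightarrow> real^'m) set"
    and A :: "nat \<Rightarrow> 'w \<Rightarrow> real^'n^'n" and B :: "nat \<Rightarrow> 'w \<Rightarrow> real^'m^'n"
    and W :: "nat \<Rightarrow> 'w \<Rightarrow> real^'n"
    and L :: "nat \<Rightarrow> (real^'n) \<times> (real^'m) \<Rightarrow> 'w \<Rightarrow> ereal"
    and x p :: "nat \<Rightarrow> 'w \<Rightarrow> (real^'n) \<times> (real^'m)" and y :: "nat \<Rightarrow> 'w \<Rightarrow> real^'n"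
  assumes "prob_space M"
    and "finite_filtration M T F"
    and "solid_decomposable_space M S" and "solid_decomposable_space M S'"
    and "separating_duality M S S'"
    and "solid_decomposable_space M C" and "solid_decomposable_space M C'"
    and "separating_duality M C C'"
    and "\<forall>t\<in>{1..T}. A t \<in> borel_measurable (F t)"
    and "\<forall>t\<in>{1..T}. B t \<in> borel_measurable (F t)"
    and "\<forall>t\<in>{1..T}. W t \<in> borel_measurable (F t)"
    and "W \<in> state_processes T S"
    and "\<forall>t\<le>T. convex_normal_integrand M (L t)"
    and "dom_Ef M T A B L \<inter> (pair_processes T S C \<times> state_processes T S) \<noteq> {}"
    and "\<exists>x. oc_feasible M T F A B W L x"
    and "\<exists>p y. dual_feasible M T F S S' C C' A B L p y"
  shows "(oc_solves M T F A B W L x \<and> dual_solves M T F S S' C C' A B W L p y \<and>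
          oc_value M T F A B W L = dual_value M T F S S' C C' A B W L)
     \<longleftrightarrow>
         (oc_feasible M T F A B W L x \<and> dual_feasible M T F S S' C C' A B L p y \<and>
          (AE w in M.
             (\<forall>t\<le>T. dual_arg T A B p y t w \<in> subdifferential (\<lambda>\<xi>. L t \<xi> w) (x t w)) \<and>
             (\<forall>t\<in>{1..T}. system_equation A B W x t w)))"
proof -
  note weak = weak_duality[OF assms(2-6,8-10,12,13)]
  have value_le: "dual_value M T F S S' C C' A B W L \<le> oc_value M T F A B W L"
    unfolding dual_value_def oc_value_def
  proof (intro SUP_least INF_greatest, clarify)
    fix p y x
    assume py: "(p, y) \<in> dual_constraint_set M T F S S' C C'" and x: "x \<in> oc_constraint_set M T F A B W"
    show "dual_objective M T A B W L p y \<le> oc_objective M T L x"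
    \<comment> \<open>The constraint sets also contain points of infinite cost; there the primal
      objective is \<infinity> or the dual objective is -\<infinity>, and the inequality is
      trivial.\<close>
    proof (cases "oc_objective M T L x < \<infinity> \<and> conj_cost M T A B L p y < \<infinity>")
      case True
      then show ?thesis
        using weak(1) py x by (simp add: oc_feasible_def dual_feasible_def)
    qed (auto simp: dual_objective_def)
  qed
  have upper: "oc_value M T F A B W L \<le> oc_objective M T L x" if "oc_feasible M T F A B W L x"
    using that unfolding oc_value_def oc_feasible_def by (auto intro: INF_lower)
  have lower: "dual_objective M T A B W L p y \<le> dual_value M T F S S' C C' A B W L"
    if "dual_feasible M T F S S' C C' A B L p y"
    using that unfolding dual_value_def dual_feasible_def by (auto intro: SUP_upper2)
  have sys: "AE w in M. \<forall>t\<in>{1..T}. system_equation A B W x t w" if "oc_feasible M T F A B W L x"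
    using that by (simp add: oc_feasible_def oc_constraint_set_def)
  show ?thesis (is "?lhs \<longleftrightarrow> ?rhs")
  proof
    assume ?lhs
    then have feas: "oc_feasible M T F A B W L x" "dual_feasible M T F S S' C C' A B L p y"
      and "dual_objective M T A B W L p y = oc_objective M T L x"
      by (auto simp: oc_solves_def dual_solves_def)
    then have "AE w in M. \<forall>t\<le>T. dual_arg T A B p y t w \<in> subdifferential (\<lambda>\<xi>. L t \<xi> w) (x t w)"
      using weak(2)[OF feas] by blast
    with feas sys[OF feas(1)] show ?rhs
      by (auto elim: eventually_elim2)
  next
    assume r: ?rhs
    then have feas: "oc_feasible M T F A B W L x" "dual_feasible M T F S S' C C' A B L p y"
      and "AE w in M. \<forall>t\<le>T. dual_arg T A B p y t w \<in> subdifferential (\<lambda>\<xi>. L t \<xi> w) (x t w)"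
      by (auto elim: eventually_mono)
    then have "dual_objective M T A B W L p y = oc_objective M T L x"
      using weak(2)[OF feas] by blast
    \<comment> \<open>In the chain dual objective \<le> dual value \<le> primal value \<le> primal
      objective the ends agree, so all four coincide.\<close>
    then show ?lhs
      using feas upper[OF feas(1)] lower[OF feas(2)] value_le
      by (auto simp: oc_solves_def dual_solves_def)
  qed
qed

end
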